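(* Given a finite set of atomic propositions $P$, for any $n \in \mathbb{N}$ and inquisitive state-pointed modal models $\mathcal{M},s$ and $\mathcal{M}',s'$: \[ \mathcal{M},s\;\sim^n\; \mathcal{M}',s' \iff \mathcal{M},s \equiv^n_{\textsc{InqML}}\mathcal{M}',s'. \]
   Context: An inquisitive state over a set $W$ is a non-empty set $\Pi\subseteq\wp(W)$ closed downward ($s\in\Pi$, $t\subseteq s$ implies $t\in\Pi$). An inquisitive modal model $\mathcal{M}=\langle W,\Sigma,V\rangle$ consists of a set of worlds $W$, a map $\Sigma\colon W\to\wp\wp(W)$ assigning to each world an inquisitive state, and a valuation $V\colon P\to\wp(W)$; put $\sigma(w):=\bigcup\Sigma(w)$. Formulae of inquisitive modal logic $\textsc{InqML}$ are given by $\phi::= p\mid\bot\mid\phi\land\phi\mid\phi\to\phi\mid\phi\mathbin{\bar{\vee}}\phi\mid\Box\phi\mid\boxplus\phi$, where $\mathbin{\bar{\vee}}$ denotes inquisitive disjunction (and $\neg\phi:=\phi\to\bot$, $\phi\lor\psi:=\neg(\neg\phi\land\neg\psi)$). Support at an information state $s\subseteq W$: $s\models p$ iff $s\subseteq V(p)$; $s\models\bot$ iff $s=\emptyset$; $s\models\phi\land\psi$ iff both; $s\models\phi\to\psi$ iff for all $t\subseteq s$, $t\models\phi$ implies $t\models\psi$; $s\models\phi\mathbin{\bar{\vee}}\psi$ iff $s\models\phi$ or $s\models\psi$; $s\models\Box\phi$ iff $\sigma(w)\models\phi$ for all $w\in s$; $s\models\boxplus\phi$ iff $t\models\phi$ for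 all $w\in s$ and all $t\in\Sigma(w)$. $\textsc{InqML}_n$ is the set of formulae of modal depth at most $n$, and $\mathcal{M},s\equiv^n_{\textsc{InqML}}\mathcal{M}',s'$ means $s$ and $s'$ support exactly the same $\textsc{InqML}_n$-formulae. The $n$-round bisimulation game between players I and II alternates between world-positions $\langle w,w'\rangle$ and state-positions $\langle s,s'\rangle$: from a world-position, I picks a state in $\Sigma(w)$ or $\Sigma'(w')$ and II answers with a state in the inquisitive state of the other world; from a state-position, I picks a world in $s$ or $s'$ and II answers with a world in the other state; a round consists of four moves from a world-position to a world-position; a player stuck for a move loses, and II loses at any world-position whose worlds disagree on some atom of $P$; otherwise II wins. $\mathcal{M},w\sim^n\mathcal{M}',w'$ if II has a winning strategy in the $n$-round game from $\langle w,w'\rangle$; for states, $\mathcal{M},s\sim^n\mathcal{M}',s'$ if every world of $s$ is $n$-bisimilar to some world of $s'$ and vice versa. *)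

theory Defs
  imports Main
begin

definition inquisitive_state :: "'w set \<Rightarrow> 'w set set \<Rightarrow> bool" where
  "inquisitive_state W \<Pi> \<longleftrightarrow>
     \<Pi> \<subseteq> Pow W \<and> \<Pi> \<noteq> {} \<and> (\<forall>s\<in>\<Pi>. \<forall>t. t \<subseteq> s \<longrightarrow> t \<in> \<Pi>)"

record ('p, 'w) model =
  worlds :: "'w set"
  inq :: "'w \<Rightarrow> 'w set set"
  val :: "'p \<Rightarrow> 'w set"

text \<open>The values of \<^term>\<open>inq\<close> outside \<^term>\<open>worlds\<close> and those of \<^term>\<open>val\<close> outside
  the set \<open>P\<close> of atomic propositions are junk and left unconstrained.\<close>

definition inq_modal_model :: "'p set \<Rightarrow> ('p, 'w) model \<Rightarrow> bool" where
  "inq_modal_model P M \<longleftrightarrow>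
     (\<forall>w\<in>worlds M. inquisitive_state (worlds M) (inq M w)) \<and>
     (\<forall>p\<in>P. val M p \<subseteq> worlds M)"

definition info :: "('p, 'w) model \<Rightarrow> 'w \<Rightarrow> 'w set" where
  "info M w = \<Union>(inq M w)"

datatype (atoms: 'p) form =
    Atom 'p
  | Bot
  | And "'p form" "'p form"
  | Imp "'p form" "'p form"
  | IDisj "'p form" "'p form"
  | Box "'p form"
  | WBox "'p form"

text \<open>\<^term>\<open>IDisj\<close> is inquisitive disjunction; \<^term>\<open>WBox\<close> is the modality \<open>\<boxplus>\<close>.\<close>

primrec supports :: "('p, 'w) model \<Rightarrow> 'w set \<Rightarrow> 'p form \<Rightarrow> bool" where
  "supports M s (Atom p) \<longleftrightarrow> s \<subseteq> val M p"
| "supports M s Bot \<longleftrightarrow> s = {}"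
| "supports M s (And \<phi> \<psi>) \<longleftrightarrow> supports M s \<phi> \<and> supports M s \<psi>"
| "supports M s (Imp \<phi> \<psi>) \<longleftrightarrow> (\<forall>t. t \<subseteq> s \<longrightarrow> supports M t \<phi> \<longrightarrow> supports M t \<psi>)"
| "supports M s (IDisj \<phi> \<psi>) \<longleftrightarrow> supports M s \<phi> \<or> supports M s \<psi>"
| "supports M s (Box \<phi>) \<longleftrightarrow> (\<forall>w\<in>s. supports M (info M w) \<phi>)"
| "supports M s (WBox \<phi>) \<longleftrightarrow> (\<forall>w\<in>s. \<forall>t\<in>inq M w. supports M t \<phi>)"

primrec modal_depth :: "'p form \<Rightarrow> nat" where
  "modal_depth (Atom p) = 0"
| "modal_depth Bot = 0"
| "modal_depth (And \<phi> \<psi>) = max (modal_depth \<phi>) (modal_depth \<psi>)"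
| "modal_depth (Imp \<phi> \<psi>) = max (modal_depth \<phi>) (modal_depth \<psi>)"
| "modal_depth (IDisj \<phi> \<psi>) = max (modal_depth \<phi>) (modal_depth \<psi>)"
| "modal_depth (Box \<phi>) = Suc (modal_depth \<phi>)"
| "modal_depth (WBox \<phi>) = Suc (modal_depth \<phi>)"

definition InqML :: "'p set \<Rightarrow> nat \<Rightarrow> 'p form set" where
  "InqML P n = {\<phi>. atoms \<phi> \<subseteq> P \<and> modal_depth \<phi> \<le> n}"

definition inqml_equiv ::
  "'p set \<Rightarrow> nat \<Rightarrow> ('p, 'a) model \<Rightarrow> 'a set \<Rightarrow> ('p, 'b) model \<Rightarrow> 'b set \<Rightarrow> bool" where
  "inqml_equiv P n M s M' s' \<longleftrightarrow> (\<forall>\<phi>\<in>InqML P n. supports M s \<phi> \<longleftrightarrow> supports M' s' \<phi>)"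

text \<open>Besides the positions \<open>Worlds w w'\<close> and \<open>States s s'\<close>, where player I is to move, there
  are the intermediate positions in which player I has just made a choice on the left or on the
  right, and player II has to answer on the other side.\<close>

datatype ('a, 'b) position =
    Worlds 'a 'b
  | State_Left "'a set" 'b
  | State_Right 'a "'b set"
  | States "'a set" "'b set"
  | World_Left 'a "'b set"
  | World_Right "'a set" 'b

fun I_to_move :: "('a, 'b) position \<Rightarrow> bool" where
  "I_to_move (Worlds w w') = True"
| "I_to_move (States s s') = True"
| "I_to_move _ = False"

inductive move ::
  "('p, 'a) model \<Rightarrow> ('p, 'b) model \<Rightarrow> ('a, 'b) position \<Rightarrow> ('a, 'b) position \<Rightarrow> bool"
  for M M' where
  "s \<in> inq M w \<Longrightarrow> move M M' (Worlds w w') (State_Left s w')"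
| "s' \<in> inq M' w' \<Longrightarrow> move M M' (Worlds w w') (State_Right w s')"
| "s' \<in> inq M' w' \<Longrightarrow> move M M' (State_Left s w') (States s s')"
| "s \<in> inq M w \<Longrightarrow> move M M' (State_Right w s') (States s s')"
| "w \<in> s \<Longrightarrow> move M M' (States s s') (World_Left w s')"
| "w' \<in> s' \<Longrightarrow> move M M' (States s s') (World_Right s w')"
| "w' \<in> s' \<Longrightarrow> move M M' (World_Left w s') (Worlds w w')"
| "w \<in> s \<Longrightarrow> move M M' (World_Right s w') (Worlds w w')"

definition stuck :: "('p, 'a) model \<Rightarrow> ('p, 'b) model \<Rightarrow> ('a, 'b) position \<Rightarrow> bool" where
  "stuck M M' q \<longleftrightarrow> (\<nexists>q'. move M M' q q')"

text \<open>A strategy for player II maps a history, i.e. the non-empty list of the positions visited so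
  far (the current one last), to the next position.\<close>

definition strategy ::
  "('p, 'a) model \<Rightarrow> ('p, 'b) model \<Rightarrow> (('a, 'b) position list \<Rightarrow> ('a, 'b) position) \<Rightarrow> bool" where
  "strategy M M' f \<longleftrightarrow>
     (\<forall>h. h \<noteq> [] \<longrightarrow> \<not> I_to_move (last h) \<longrightarrow> \<not> stuck M M' (last h)
        \<longrightarrow> move M M' (last h) (f h))"

text \<open>Histories of (possibly unfinished) plays from \<open>q0\<close> in which player II follows \<open>f\<close>.\<close>

inductive play ::
  "('p, 'a) model \<Rightarrow> ('p, 'b) model \<Rightarrow> (('a, 'b) position list \<Rightarrow> ('a, 'b) position)
     \<Rightarrow> ('a, 'b) position \<Rightarrow> ('a, 'b) position list \<Rightarrow> bool"
  for M M' f q0 where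
  start: "play M M' f q0 [q0]"
| move_I: "play M M' f q0 h \<Longrightarrow> I_to_move (last h) \<Longrightarrow> move M M' (last h) q
    \<Longrightarrow> play M M' f q0 (h @ [q])"
| move_II: "play M M' f q0 h \<Longrightarrow> \<not> I_to_move (last h) \<Longrightarrow> move M M' (last h) (f h)
    \<Longrightarrow> play M M' f q0 (h @ [f h])"

definition atom_equiv ::
  "'p set \<Rightarrow> ('p, 'a) model \<Rightarrow> 'a \<Rightarrow> ('p, 'b) model \<Rightarrow> 'b \<Rightarrow> bool" where
  "atom_equiv P M w M' w' \<longleftrightarrow> (\<forall>p\<in>P. w \<in> val M p \<longleftrightarrow> w' \<in> val M' p)"

definition lost_for_II ::
  "'p set \<Rightarrow> ('p, 'a) model \<Rightarrow> ('p, 'b) model \<Rightarrow> ('a, 'b) position \<Rightarrow> bool" where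
  "lost_for_II P M M' q \<longleftrightarrow>
     (\<exists>w w'. q = Worlds w w' \<and> \<not> atom_equiv P M w M' w') \<or>
     (\<not> I_to_move q \<and> stuck M M' q)"

text \<open>A round consists of four moves, so a history of the \<open>n\<close>-round game has at most \<open>4 * n + 1\<close>
  positions. Player II wins a play precisely if it never reaches a position lost for II; this
  includes the plays in which player I gets stuck.\<close>

definition winning_strategy ::
  "'p set \<Rightarrow> nat \<Rightarrow> ('p, 'a) model \<Rightarrow> ('p, 'b) model \<Rightarrow> ('a, 'b) position
     \<Rightarrow> (('a, 'b) position list \<Rightarrow> ('a, 'b) position) \<Rightarrow> bool" where
  "winning_strategy P n M M' q0 f \<longleftrightarrow>
     strategy M M' f \<and>
     (\<forall>h. play M M' f q0 h \<longrightarrow> length h \<le> 4 * n + 1 \<longrightarrow> \<not> lost_for_II P M M' (last h))"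

definition world_bisim ::
  "'p set \<Rightarrow> nat \<Rightarrow> ('p, 'a) model \<Rightarrow> 'a \<Rightarrow> ('p, 'b) model \<Rightarrow> 'b \<Rightarrow> bool" where
  "world_bisim P n M w M' w' \<longleftrightarrow> (\<exists>f. winning_strategy P n M M' (Worlds w w') f)"

definition state_bisim ::
  "'p set \<Rightarrow> nat \<Rightarrow> ('p, 'a) model \<Rightarrow> 'a set \<Rightarrow> ('p, 'b) model \<Rightarrow> 'b set \<Rightarrow> bool" where
  "state_bisim P n M s M' s' \<longleftrightarrow>
     (\<forall>w\<in>s. \<exists>w'\<in>s'. world_bisim P n M w M' w') \<and>
     (\<forall>w'\<in>s'. \<exists>w\<in>s. world_bisim P n M w M' w')"

end

theory Submission imports Defs begin

text \<open>Unravelling the four moves of a round shows that \<open>n\<close>-bisimilarity is the usual recursive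
  back-and-forth condition. Invariance of support is then an induction on formulae, in which a substate \<open>t\<close> of \<open>s\<close> is
  matched by the set of all worlds of \<open>s'\<close> bisimilar to a world of \<open>t\<close>.

  For the converse there are, for finite \<open>P\<close>, finitely many test formulae of modal depth at most
  \<open>n\<close> such that worlds satisfying the same tests (having the same type) are \<open>n\<close>-bisimilar. As
  negations are flat, a negated formula can say of a state that the types of its worlds all belong
  to a given finite set \<open>R\<close>. The tests of depth \<open>n + 1\<close> express, for a set \<open>T\<close> of depth-\<open>n\<close> types,
  that no \<open>t \<in> \<Sigma>(w)\<close> realises all of \<open>T\<close>, namely through \<open>\<boxplus>\<close> applied to the inquisitive
  disjunction, over all \<open>R\<close> not including \<open>T\<close>, of the formulae for \<open>R\<close>. Downward closure of
  \<open>\<Sigma>(w)\<close> then yields a state realising exactly \<open>T\<close>.\<close>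

section \<open>The game and back-and-forth bisimilarity\<close>

text \<open>The value of the game by backward induction, free of histories and strategies. The
  number counts single moves left, so a full round takes four.\<close>

primrec survives ::
  "'p set \<Rightarrow> ('p, 'a) model \<Rightarrow> ('p, 'b) model \<Rightarrow> nat \<Rightarrow> ('a, 'b) position \<Rightarrow> bool" where
  "survives P M M' 0 q \<longleftrightarrow> \<not> lost_for_II P M M' q"
| "survives P M M' (Suc k) q \<longleftrightarrow> \<not> lost_for_II P M M' q \<and>
     (if I_to_move q then \<forall>q'. move M M' q q' \<longrightarrow> survives P M M' k q'
      else \<exists>q'. move M M' q q' \<and> survives P M M' k q')"

lemma survives_not_lost: "survives P M M' k q \<Longrightarrow> \<not> lost_for_II P M M' q"
  by (cases k) auto

lemma play_not_Nil: "play M M' f q0 h \<Longrightarrow> h \<noteq> []"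
  by (induction rule: play.induct) auto

text \<open>Induction on the moves left. A history with \<open>length h\<close> positions has used
  \<open>length h - 1\<close> moves, whence the bound \<open>4 * n + 1\<close> shared between
  \<open>h\<close> and \<open>k\<close>.\<close>

lemma winning_strategy_imp_survives:
  assumes win: "winning_strategy P n M M' q0 f"
  shows "play M M' f q0 h \<Longrightarrow> length h + k = 4 * n + 1 \<Longrightarrow> survives P M M' k (last h)"
proof (induction k arbitrary: h)
  case 0
  then show ?case using win by (auto simp: winning_strategy_def)
next
  case (Suc k)
  have nl: "\<not> lost_for_II P M M' (last h)"
    using win Suc.prems by (auto simp: winning_strategy_def)
  show ?case
  proof (cases "I_to_move (last h)")
    case True
    have "survives P M M' k q" if "move M M' (last h) q" for q
      using Suc.IH[OF play.move_I[OF Suc.prems(1) True that]] Suc.prems(2) by simp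
    then show ?thesis using nl True by simp
  next
    case False
    then have "\<not> stuck M M' (last h)" using nl by (auto simp: lost_for_II_def)
    then have mv: "move M M' (last h) (f h)"
      using win False play_not_Nil[OF Suc.prems(1)]
      by (auto simp: winning_strategy_def strategy_def)
    have "survives P M M' k (f h)"
      using Suc.IH[OF play.move_II[OF Suc.prems(1) False mv]] Suc.prems(2) by simp
    then show ?thesis using nl False mv by auto
  qed
qed

lemma survives_imp_winning_strategy:
  assumes "survives P M M' (4 * n) q0"
  shows "\<exists>f. winning_strategy P n M M' q0 f"
proof -
  \<comment> \<open>Before the move from \<open>last h\<close>, \<open>4 * n + 1 - length h\<close>
    moves remain; the move to \<open>q\<close> uses one of them.\<close>
  define good where
    "good h q \<longleftrightarrow> move M M' (last h) q \<and> survives P M M' (4 * n - length h) q" for h q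
  \<comment> \<open>The second choice is a default: \<open>strategy\<close> demands a legal move
    after every history, even one where no surviving move exists.\<close>
  define f where
    "f h = (if \<exists>q. good h q then SOME q. good h q else SOME q. move M M' (last h) q)" for h
  have f_good: "good h (f h)" if "\<exists>q. good h q" for h
    using someI_ex[OF that] that by (simp add: f_def)
  have "strategy M M' f"
    unfolding strategy_def
  proof (intro allI impI)
    fix h assume "\<not> stuck M M' (last h)"
    then have ex: "\<exists>q. move M M' (last h) q" by (simp add: stuck_def)
    show "move M M' (last h) (f h)"
      using f_good[of h] someI_ex[OF ex] by (cases "\<exists>q. good h q") (auto simp: good_def f_def)
  qed
  moreover have "survives P M M' (4 * n + 1 - length h) (last h)"
    if "play M M' f q0 h" "length h \<le> 4 * n + 1" for h
    using that
  proof (induction rule: play.induct)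
    case start
    then show ?case using assms by simp
  next
    case (move_I h q)
    then have "4 * n + 1 - length h = Suc (4 * n - length h)" by simp
    then show ?case using move_I by simp
  next
    case (move_II h)
    then have "4 * n + 1 - length h = Suc (4 * n - length h)" by simp
    then have "\<exists>q. good h q" using move_II by (simp add: good_def)
    from f_good[OF this] show ?case by (simp add: good_def)
  qed
  ultimately show ?thesis
    unfolding winning_strategy_def using survives_not_lost by blast
qed

lemma world_bisim_iff_survives:
  "world_bisim P n M w M' w' \<longleftrightarrow> survives P M M' (4 * n) (Worlds w w')"
  unfolding world_bisim_def
  using winning_strategy_imp_survives[OF _ play.start, of P n M M' "Worlds w w'" _ "4 * n"]
    survives_imp_winning_strategy by auto

\<comment> \<open>One round as a back-and-forth condition\<close>
inductive_simps move_simps: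
  "move M M' (Worlds w w') q" "move M M' (State_Left s w') q" "move M M' (State_Right w s') q"
  "move M M' (States s s') q" "move M M' (World_Left w s') q" "move M M' (World_Right s w') q"

text \<open>The Egli-Milner lifting of a relation. Applied to worlds it gives bisimilarity of
  states, applied once more it compares inquisitive states.\<close>

definition set_match :: "('a \<Rightarrow> 'b \<Rightarrow> bool) \<Rightarrow> 'a set \<Rightarrow> 'b set \<Rightarrow> bool" where
  "set_match R A B \<longleftrightarrow> (\<forall>a\<in>A. \<exists>b\<in>B. R a b) \<and> (\<forall>b\<in>B. \<exists>a\<in>A. R a b)"

text \<open>A subset is matched with the set of all partners of its elements. This serves the
  quantifier over substates in implication.\<close>

lemma set_match_Pow:
  assumes "set_match R A B"
  shows "set_match (set_match R) (Pow A) (Pow B)"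
proof -
  have "set_match R C {b \<in> B. \<exists>a\<in>C. R a b}" if "C \<subseteq> A" for C
    using assms that unfolding set_match_def by fast
  moreover have "set_match R {a \<in> A. \<exists>b\<in>D. R a b} D" if "D \<subseteq> B" for D
    using assms that unfolding set_match_def by fast
  ultimately show ?thesis
    unfolding set_match_def[of "set_match R"] by (metis (lifting) Pow_iff mem_Collect_eq subsetI)
qed

text \<open>The support clauses of atoms, implication and both modalities are universal
  quantifications over worlds or states; this carries them across a matching.\<close>

lemma set_match_ball_iff:
  assumes "set_match R A B" and "\<And>a b. R a b \<Longrightarrow> p a \<longleftrightarrow> q b"
  shows "(\<forall>a\<in>A. p a) \<longleftrightarrow> (\<forall>b\<in>B. q b)"
  using assms unfolding set_match_def by metis

lemma set_match_Union:
  "set_match (set_match R) \<A> \<B> \<Longrightarrow> set_match R (\<Union>\<A>) (\<Union>\<B>)"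
  unfolding set_match_def by fast

lemma set_match_image_eq:
  assumes "f ` A = g ` B" and "\<And>a b. a \<in> A \<Longrightarrow> b \<in> B \<Longrightarrow> f a = g b \<Longrightarrow> R a b"
  shows "set_match R A B"
  unfolding set_match_def
proof (intro conjI ballI)
  show "\<exists>b\<in>B. R a b" if "a \<in> A" for a
    using imageI[OF that, of f] assms(2)[OF that] unfolding assms(1) by blast
  show "\<exists>a\<in>A. R a b" if "b \<in> B" for b
    using imageI[OF that, of g] assms(2)[OF _ that] unfolding assms(1)[symmetric] by force
qed

lemma state_bisim_eq_set_match:
  "state_bisim P n M s M' s' = set_match (\<lambda>w w'. world_bisim P n M w M' w') s s'"
  by (simp add: state_bisim_def set_match_def)

lemma world_bisim_0: "world_bisim P 0 M w M' w' \<longleftrightarrow> atom_equiv P M w M' w'"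
  by (simp add: world_bisim_iff_survives lost_for_II_def)

lemma survives_World_Left:
  "survives P M M' (Suc k) (World_Left w s') \<longleftrightarrow> (\<exists>w'\<in>s'. survives P M M' k (Worlds w w'))"
  by (auto simp: lost_for_II_def stuck_def move_simps)

lemma survives_World_Right:
  "survives P M M' (Suc k) (World_Right s w') \<longleftrightarrow> (\<exists>w\<in>s. survives P M M' k (Worlds w w'))"
  by (auto simp: lost_for_II_def stuck_def move_simps)

lemma survives_States:
  "survives P M M' (Suc (Suc k)) (States s s') \<longleftrightarrow>
     set_match (\<lambda>w w'. survives P M M' k (Worlds w w')) s s'"
  \<comment> \<open>Only player I's move is unfolded; the inner \<open>Suc k\<close> stays intact
    for the lemmas on player II's answers.\<close>
  unfolding survives.simps(2)[of P M M' "Suc k"]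
  by (auto simp: lost_for_II_def move_simps set_match_def survives_World_Left survives_World_Right
      simp del: survives.simps(2))

lemma survives_State_Left:
  "survives P M M' (Suc k) (State_Left s w') \<longleftrightarrow>
     (\<exists>s'\<in>inq M' w'. survives P M M' k (States s s'))"
  by (auto simp: lost_for_II_def stuck_def move_simps)

lemma survives_State_Right:
  "survives P M M' (Suc k) (State_Right w s') \<longleftrightarrow>
     (\<exists>s\<in>inq M w. survives P M M' k (States s s'))"
  by (auto simp: lost_for_II_def stuck_def move_simps)

lemma survives_Worlds:
  "survives P M M' (Suc (Suc k)) (Worlds w w') \<longleftrightarrow> atom_equiv P M w M' w' \<and>
     set_match (\<lambda>s s'. survives P M M' k (States s s')) (inq M w) (inq M' w')"
  unfolding survives.simps(2)[of P M M' "Suc k"]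
  by (auto simp: lost_for_II_def move_simps set_match_def survives_State_Left survives_State_Right
      simp del: survives.simps(2))

lemma world_bisim_Suc:
  "world_bisim P (Suc n) M w M' w' \<longleftrightarrow> atom_equiv P M w M' w' \<and>
     set_match (\<lambda>s s'. state_bisim P n M s M' s') (inq M w) (inq M' w')"
proof -
  have "4 * Suc n = Suc (Suc (Suc (Suc (4 * n))))" by simp
  then show ?thesis
    by (simp only: world_bisim_iff_survives state_bisim_eq_set_match survives_Worlds survives_States)
qed

lemma world_bisim_atom_equiv: "world_bisim P n M w M' w' \<Longrightarrow> atom_equiv P M w M' w'"
  by (cases n) (simp_all add: world_bisim_0 world_bisim_Suc)

section \<open>Bisimulation invariance\<close>

lemma state_bisim_supports:
  assumes "state_bisim P n M s M' s'" and "\<phi> \<in> InqML P n"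
  shows "supports M s \<phi> \<longleftrightarrow> supports M' s' \<phi>"
  using assms
proof (induction \<phi> arbitrary: n s s')
  case (Atom p)
  have "w \<in> val M p \<longleftrightarrow> w' \<in> val M' p" if "world_bisim P n M w M' w'" for w w'
    using world_bisim_atom_equiv[OF that] Atom.prems(2) by (simp add: atom_equiv_def InqML_def)
  from set_match_ball_iff[OF Atom.prems(1)[unfolded state_bisim_eq_set_match] this]
  show ?case by (simp add: subset_eq)
next
  case Bot
  then show ?case by (auto simp: state_bisim_def)
next
  case (Imp \<phi> \<psi>)
  have ml: "\<phi> \<in> InqML P n" "\<psi> \<in> InqML P n" using Imp.prems(2) by (auto simp: InqML_def)
  have "(supports M t \<phi> \<longrightarrow> supports M t \<psi>) \<longleftrightarrow> (supports M' t' \<phi> \<longrightarrow> supports M' t' \<psi>)"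
    if "state_bisim P n M t M' t'" for t t'
    using Imp.IH(1)[OF that ml(1)] Imp.IH(2)[OF that ml(2)] by simp
  from set_match_ball_iff[OF set_match_Pow[OF Imp.prems(1)[unfolded state_bisim_eq_set_match]]
      this[unfolded state_bisim_eq_set_match]]
  show ?case by (simp add: Ball_def)
next
  case (Box \<phi>)
  then obtain m where n: "n = Suc m" and ml: "\<phi> \<in> InqML P m"
    by (cases n) (auto simp: InqML_def)
  have "supports M (info M w) \<phi> \<longleftrightarrow> supports M' (info M' w') \<phi>"
    if "world_bisim P n M w M' w'" for w w'
  proof (rule Box.IH[OF _ ml])
    \<comment> \<open>Unions of matched families of states are matched, which settles
      \<open>\<sigma>(w)\<close> against \<open>\<sigma>(w')\<close>.\<close>
    show "state_bisim P m M (info M w) M' (info M' w')"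
      using that unfolding n world_bisim_Suc state_bisim_eq_set_match info_def
      by (auto intro: set_match_Union)
  qed
  from set_match_ball_iff[OF Box.prems(1)[unfolded state_bisim_eq_set_match] this]
  show ?case by simp
next
  case (WBox \<phi>)
  then obtain m where n: "n = Suc m" and ml: "\<phi> \<in> InqML P m"
    by (cases n) (auto simp: InqML_def)
  have "(\<forall>t\<in>inq M w. supports M t \<phi>) \<longleftrightarrow> (\<forall>t'\<in>inq M' w'. supports M' t' \<phi>)"
    if "world_bisim P n M w M' w'" for w w'
    by (rule set_match_ball_iff[OF conjunct2 WBox.IH[OF _ ml]]) (fact that[unfolded n world_bisim_Suc])
  from set_match_ball_iff[OF WBox.prems(1)[unfolded state_bisim_eq_set_match] this]
  show ?case by simp
next
  case (And \<phi> \<psi>)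
  then show ?case by (simp add: InqML_def)
next
  case (IDisj \<phi> \<psi>)
  then show ?case by (simp add: InqML_def)
qed

section \<open>Persistence and definable connectives\<close>

lemma supports_empty: "supports M {} \<phi>"
  by (induction \<phi>) auto

lemma supports_mono: "supports M s \<phi> \<Longrightarrow> t \<subseteq> s \<Longrightarrow> supports M t \<phi>"
proof (induction \<phi>)
  case (Imp \<phi> \<psi>)
  then show ?case by (meson order_trans supports.simps(4))
qed auto

abbreviation Neg :: "'p form \<Rightarrow> 'p form" where
  "Neg \<phi> \<equiv> Imp \<phi> Bot"

text \<open>Flatness of negation: by persistence, a nonempty substate supporting
  \<open>\<phi>\<close> contains a singleton that supports it.\<close>

lemma supports_Neg: "supports M s (Neg \<phi>) \<longleftrightarrow> (\<forall>w\<in>s. \<not> supports M {w} \<phi>)"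
proof
  assume "supports M s (Neg \<phi>)"
  then show "\<forall>w\<in>s. \<not> supports M {w} \<phi>" by auto
next
  assume none: "\<forall>w\<in>s. \<not> supports M {w} \<phi>"
  have "t = {}" if "t \<subseteq> s" "supports M t \<phi>" for t
  proof (rule equals0I)
    fix w assume "w \<in> t"
    then show False using none that supports_mono[OF that(2), of "{w}"] by blast
  qed
  then show "supports M s (Neg \<phi>)" by simp
qed

text \<open>The choice of an enumerating list is only meaningful for finite sets.\<close>

definition BigAnd :: "'p form set \<Rightarrow> 'p form" where
  "BigAnd A = foldr And (SOME xs. set xs = A) (Neg Bot)"

definition BigIDisj :: "'p form set \<Rightarrow> 'p form" where
  "BigIDisj A = foldr IDisj (SOME xs. set xs = A) Bot"

lemma set_SOME: "finite A \<Longrightarrow> set (SOME xs. set xs = A) = A"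
  by (rule someI_ex) (rule finite_list)

lemma supports_BigAnd:
  assumes "finite A"
  shows "supports M s (BigAnd A) \<longleftrightarrow> (\<forall>\<phi>\<in>A. supports M s \<phi>)"
proof -
  have "supports M s (foldr And xs (Neg Bot)) \<longleftrightarrow> (\<forall>\<phi>\<in>set xs. supports M s \<phi>)" for xs
    by (induction xs) auto
  then show ?thesis by (simp only: BigAnd_def set_SOME[OF assms])
qed

lemma supports_BigIDisj:
  assumes "finite A"
  shows "supports M s (BigIDisj A) \<longleftrightarrow> s = {} \<or> (\<exists>\<phi>\<in>A. supports M s \<phi>)"
proof -
  have "supports M s (foldr IDisj xs Bot) \<longleftrightarrow> s = {} \<or> (\<exists>\<phi>\<in>set xs. supports M s \<phi>)" for xs
    by (induction xs) auto
  then show ?thesis by (simp only: BigIDisj_def set_SOME[OF assms])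
qed

lemma Neg_in_InqML: "Neg \<phi> \<in> InqML P n \<longleftrightarrow> \<phi> \<in> InqML P n"
  by (simp add: InqML_def)

lemma BigAnd_in_InqML:
  assumes "finite A" "A \<subseteq> InqML P n"
  shows "BigAnd A \<in> InqML P n"
proof -
  have "set xs \<subseteq> InqML P n \<Longrightarrow> foldr And xs (Neg Bot) \<in> InqML P n" for xs
    by (induction xs) (auto simp: InqML_def)
  then show ?thesis by (simp only: BigAnd_def set_SOME assms)
qed

lemma BigIDisj_in_InqML:
  assumes "finite A" "A \<subseteq> InqML P n"
  shows "BigIDisj A \<in> InqML P n"
proof -
  have "set xs \<subseteq> InqML P n \<Longrightarrow> foldr IDisj xs Bot \<in> InqML P n" for xs
    by (induction xs) (auto simp: InqML_def)
  then show ?thesis by (simp only: BigIDisj_def set_SOME assms)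
qed

section \<open>Types\<close>

definition type_of :: "'p form set \<Rightarrow> ('p, 'w) model \<Rightarrow> 'w \<Rightarrow> 'p form set" where
  "type_of F M w = {\<phi> \<in> F. supports M {w} \<phi>}"

definition type_form :: "'p form set \<Rightarrow> 'p form set \<Rightarrow> 'p form" where
  "type_form F A = BigAnd (A \<union> Neg ` (F - A))"

text \<open>The classical disjunction of characteristic formulae, in De Morgan form. It lets the
  disjunct vary from world to world, whereas \<open>IDisj\<close> would ask the whole state to
  support a single one.\<close>

definition types_within :: "'p form set \<Rightarrow> 'p form set set \<Rightarrow> 'p form" where
  "types_within F R = Neg (BigAnd ((\<lambda>A. Neg (type_form F A)) ` R))"

lemma type_of_subset: "type_of F M ` s \<subseteq> Pow F"
  by (auto simp: type_of_def)

lemma supports_type_form: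
  assumes "finite F" "A \<subseteq> F"
  shows "supports M {w} (type_form F A) \<longleftrightarrow> type_of F M w = A"
proof -
  have "finite (A \<union> Neg ` (F - A))" using assms finite_subset by auto
  then have "supports M {w} (type_form F A) \<longleftrightarrow>
      (\<forall>\<phi>\<in>A. supports M {w} \<phi>) \<and> (\<forall>\<phi>\<in>F - A. \<not> supports M {w} \<phi>)"
    unfolding type_form_def
    by (simp only: supports_BigAnd) (simp add: ball_Un supports_Neg del: supports.simps)
  also have "\<dots> \<longleftrightarrow> type_of F M w = A"
    using assms(2) by (auto simp: type_of_def)
  finally show ?thesis .
qed

lemma supports_types_within:
  assumes "finite F" "R \<subseteq> Pow F"
  shows "supports M s (types_within F R) \<longleftrightarrow> type_of F M ` s \<subseteq> R"
proof -
  have "finite R" using assms finite_subset by auto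
  then have "supports M s (types_within F R) \<longleftrightarrow>
      (\<forall>w\<in>s. \<exists>A\<in>R. supports M {w} (type_form F A))"
    unfolding types_within_def by (simp add: supports_Neg supports_BigAnd del: supports.simps)
  also have "\<dots> \<longleftrightarrow> (\<forall>w\<in>s. \<exists>A\<in>R. type_of F M w = A)"
    using assms supports_type_form by (metis PowD subsetD)
  finally show ?thesis by auto
qed

lemma types_within_in_InqML:
  assumes "finite F" "F \<subseteq> InqML P n" "R \<subseteq> Pow F"
  shows "types_within F R \<in> InqML P n"
proof -
  have "type_form F A \<in> InqML P n" if "A \<in> R" for A
    unfolding type_form_def
  proof (rule BigAnd_in_InqML)
    have "finite A" using that assms by (meson PowD finite_subset subsetD)
    then show "finite (A \<union> Neg ` (F - A))" using assms(1) by simp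
    show "A \<union> Neg ` (F - A) \<subseteq> InqML P n" using that assms by (auto simp: Neg_in_InqML)
  qed
  moreover have "finite R" using assms(1) finite_subset[OF assms(3)] by simp
  ultimately show ?thesis
    unfolding types_within_def Neg_in_InqML
    by (intro BigAnd_in_InqML) (auto simp: Neg_in_InqML)
qed

section \<open>Test formulae of increasing modal depth\<close>

definition omits_form :: "'p form set \<Rightarrow> 'p form set set \<Rightarrow> 'p form" where
  "omits_form F T = WBox (BigIDisj (types_within F ` {R. R \<subseteq> Pow F \<and> \<not> T \<subseteq> R}))"

text \<open>For nonempty \<open>t\<close>, the set of types realised in \<open>t\<close> serves as
  \<open>R\<close>. The empty state supports every formula and realises no type, in accordance with
  \<open>T \<noteq> {}\<close>.\<close>

lemma supports_omits_form:
  assumes "finite F" "T \<noteq> {}"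
  shows "supports M {w} (omits_form F T) \<longleftrightarrow> (\<forall>t\<in>inq M w. \<not> T \<subseteq> type_of F M ` t)"
proof -
  have "finite {R. R \<subseteq> Pow F \<and> \<not> T \<subseteq> R}" using assms by simp
  then have "supports M {w} (omits_form F T) \<longleftrightarrow>
      (\<forall>t\<in>inq M w. t = {} \<or> (\<exists>R. R \<subseteq> Pow F \<and> \<not> T \<subseteq> R \<and> type_of F M ` t \<subseteq> R))"
    using assms by (auto simp: omits_form_def supports_BigIDisj supports_types_within)
  also have "\<dots> \<longleftrightarrow> (\<forall>t\<in>inq M w. \<not> T \<subseteq> type_of F M ` t)"
  proof (intro ball_cong refl)
    fix t
    show "t = {} \<or> (\<exists>R. R \<subseteq> Pow F \<and> \<not> T \<subseteq> R \<and> type_of F M ` t \<subseteq> R) \<longleftrightarrow>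
        \<not> T \<subseteq> type_of F M ` t"
      using assms(2) type_of_subset[of F M t] by (cases "t = {}") (simp, meson order_refl order_trans)
  qed
  finally show ?thesis .
qed

lemma omits_form_in_InqML:
  assumes "finite F" "F \<subseteq> InqML P n"
  shows "omits_form F T \<in> InqML P (Suc n)"
proof -
  have "BigIDisj (types_within F ` {R. R \<subseteq> Pow F \<and> \<not> T \<subseteq> R}) \<in> InqML P n"
    using assms(1) types_within_in_InqML[OF assms] by (intro BigIDisj_in_InqML) auto
  then show ?thesis by (simp add: omits_form_def InqML_def)
qed

text \<open>The empty set of types is left out since the empty state, a member of every inquisitive
  state, realises exactly that set. Atoms recur at each level because every world-position checks
  them.\<close>

primrec tests :: "'p set \<Rightarrow> nat \<Rightarrow> 'p form set" where
  "tests P 0 = Atom ` P"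
| "tests P (Suc n) = Atom ` P \<union> omits_form (tests P n) ` (Pow (Pow (tests P n)) - {{}})"

lemma finite_tests: "finite P \<Longrightarrow> finite (tests P n)"
  by (induction n) auto

lemma tests_subset_InqML: "finite P \<Longrightarrow> tests P n \<subseteq> InqML P n"
proof (induction n)
  case 0
  then show ?case by (auto simp: InqML_def)
next
  case (Suc n)
  have "Atom ` P \<subseteq> InqML P (Suc n)" by (auto simp: InqML_def)
  then show ?case
    using omits_form_in_InqML[OF finite_tests Suc.IH] Suc.prems by auto
qed

lemma type_of_eq_iff:
  "type_of F M w = type_of F M' w' \<longleftrightarrow> (\<forall>\<phi>\<in>F. supports M {w} \<phi> \<longleftrightarrow> supports M' {w'} \<phi>)"
  by (auto simp: type_of_def)

lemma type_of_eq_atom_equiv: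
  "type_of (tests P n) M w = type_of (tests P n) M' w' \<Longrightarrow> atom_equiv P M w M' w'"
proof -
  assume eq: "type_of (tests P n) M w = type_of (tests P n) M' w'"
  have "Atom p \<in> tests P n" if "p \<in> P" for p using that by (cases n) simp_all
  then show ?thesis using eq[unfolded type_of_eq_iff] by (fastforce simp: atom_equiv_def)
qed

section \<open>From equal types to bisimilar worlds\<close>

lemma omits_form_realise:
  assumes "finite F" and "inquisitive_state W (inq M w)" and "t \<noteq> {}"
    and "\<not> supports M {w} (omits_form F (type_of F N ` t))"
  shows "\<exists>t'\<in>inq M w. type_of F M ` t' = type_of F N ` t"
proof -
  have ne: "type_of F N ` t \<noteq> {}" using assms(3) by simp
  obtain t' where t': "t' \<in> inq M w" "type_of F N ` t \<subseteq> type_of F M ` t'"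
    using assms(4) unfolding supports_omits_form[OF assms(1) ne] by blast
  \<comment> \<open>\<open>t'\<close> may realise too many types; discarding the surplus worlds
    stays in \<open>inq M w\<close> by downward closure.\<close>
  define t'' where "t'' = {v \<in> t'. type_of F M v \<in> type_of F N ` t}"
  have "t'' \<in> inq M w"
    using assms(2) t'(1) by (auto simp: inquisitive_state_def t''_def)
  moreover have "type_of F M ` t'' = type_of F N ` t"
  proof (intro equalityI subsetI)
    fix A assume A: "A \<in> type_of F N ` t"
    then obtain v where "v \<in> t'" "A = type_of F M v" using t'(2) by blast
    then show "A \<in> type_of F M ` t''" using A by (auto simp only: t''_def mem_Collect_eq)
  qed (auto simp only: t''_def mem_Collect_eq)
  ultimately show ?thesis by blast
qed

text \<open>The forth condition at the level of types; exchanging the models gives the back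
  condition. The state \<open>t\<close> itself refutes the test that its types are omitted, and
  equality of types transfers this refutation.\<close>

lemma type_of_Suc_realise:
  assumes "finite P" and "inquisitive_state W' (inq M' w')"
    and eq: "type_of (tests P (Suc n)) M w = type_of (tests P (Suc n)) M' w'"
    and t: "t \<in> inq M w"
  shows "\<exists>t'\<in>inq M' w'. type_of (tests P n) M' ` t' = type_of (tests P n) M ` t"
proof (cases "t = {}")
  case True
  have "{} \<in> inq M' w'" using assms(2) by (auto simp: inquisitive_state_def)
  then show ?thesis using True by force
next
  case False
  let ?F = "tests P n" and ?T = "type_of (tests P n) M ` t"
  have ne: "?T \<noteq> {}" using False by simp
  have "\<not> supports M {w} (omits_form ?F ?T)"
    unfolding supports_omits_form[OF finite_tests[OF assms(1)] ne] using t by blast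
  moreover have "omits_form ?F ?T \<in> tests P (Suc n)"
    using False type_of_subset[of ?F M t] by auto
  ultimately have "\<not> supports M' {w'} (omits_form ?F ?T)"
    using eq unfolding type_of_eq_iff by blast
  from omits_form_realise[OF finite_tests[OF assms(1)] assms(2) False this] show ?thesis .
qed

lemma type_of_eq_world_bisim:
  assumes "finite P" and M: "inq_modal_model P M" and M': "inq_modal_model P M'"
  shows "w \<in> worlds M \<Longrightarrow> w' \<in> worlds M' \<Longrightarrow>
    type_of (tests P n) M w = type_of (tests P n) M' w' \<Longrightarrow> world_bisim P n M w M' w'"
proof (induction n arbitrary: w w')
  case 0
  then show ?case unfolding world_bisim_0 by (intro type_of_eq_atom_equiv)
next
  case (Suc n)
  have inq: "inquisitive_state (worlds M) (inq M w)" "inquisitive_state (worlds M') (inq M' w')"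
    using M M' Suc.prems by (auto simp: inq_modal_model_def)
  have bisim: "state_bisim P n M t M' t'"
    if "t \<in> inq M w" "t' \<in> inq M' w'" "type_of (tests P n) M ` t = type_of (tests P n) M' ` t'"
    for t t'
  proof -
    \<comment> \<open>The induction hypothesis speaks of worlds of the models only.\<close>
    have "t \<subseteq> worlds M" "t' \<subseteq> worlds M'" using inq that by (auto simp: inquisitive_state_def)
    then show ?thesis
      unfolding state_bisim_eq_set_match
      by (intro set_match_image_eq[OF that(3)] Suc.IH) (blast+)
  qed
  have "set_match (\<lambda>s s'. state_bisim P n M s M' s') (inq M w) (inq M' w')"
    unfolding set_match_def
  proof (intro conjI ballI)
    fix t assume t: "t \<in> inq M w"
    obtain t' where t': "t' \<in> inq M' w'"
      and "type_of (tests P n) M' ` t' = type_of (tests P n) M ` t"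
      by (rule bexE[OF type_of_Suc_realise[OF assms(1) inq(2) Suc.prems(3) t]])
    from bisim[OF t t' this(2)[symmetric]] t'
    show "\<exists>t'\<in>inq M' w'. state_bisim P n M t M' t'" ..
  next
    fix t' assume t': "t' \<in> inq M' w'"
    obtain t where t: "t \<in> inq M w"
      and "type_of (tests P n) M ` t = type_of (tests P n) M' ` t'"
      by (rule bexE[OF type_of_Suc_realise[OF assms(1) inq(1) Suc.prems(3)[symmetric] t']])
    from bisim[OF t t' this(2)] t
    show "\<exists>t\<in>inq M w. state_bisim P n M t M' t'" ..
  qed
  then show ?case
    unfolding world_bisim_Suc using type_of_eq_atom_equiv[OF Suc.prems(3)] by blast
qed

lemma inqml_equiv_sym: "inqml_equiv P n M s M' s' \<Longrightarrow> inqml_equiv P n M' s' M s"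
  by (simp add: inqml_equiv_def)

text \<open>The formula confining types to those realised in \<open>s\<close> holds at
  \<open>s\<close>, hence at \<open>s'\<close>.\<close>

lemma inqml_equiv_types_subset:
  assumes "finite P" and "inqml_equiv P n M s M' s'"
  shows "type_of (tests P n) M' ` s' \<subseteq> type_of (tests P n) M ` s"
proof -
  note fin = finite_tests[OF assms(1), of n]
  let ?\<phi> = "types_within (tests P n) (type_of (tests P n) M ` s)"
  have "?\<phi> \<in> InqML P n"
    using types_within_in_InqML[OF fin tests_subset_InqML[OF assms(1)] type_of_subset] .
  moreover have "supports M s ?\<phi>"
    by (simp add: supports_types_within[OF fin type_of_subset])
  ultimately have "supports M' s' ?\<phi>"
    using assms(2) by (simp add: inqml_equiv_def)
  then show ?thesis by (simp only: supports_types_within[OF fin type_of_subset])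
qed

theorem theorem1:
  fixes P :: "'p set" and n :: nat
    and M :: "('p, 'a) model" and s :: "'a set"
    and M' :: "('p, 'b) model" and s' :: "'b set"
  assumes "finite P"
    and "inq_modal_model P M" and "s \<subseteq> worlds M"
    and "inq_modal_model P M'" and "s' \<subseteq> worlds M'"
  shows "state_bisim P n M s M' s' \<longleftrightarrow> inqml_equiv P n M s M' s'"
proof
  assume "state_bisim P n M s M' s'"
  then show "inqml_equiv P n M s M' s'"
    unfolding inqml_equiv_def by (intro ballI state_bisim_supports)
next
  assume "inqml_equiv P n M s M' s'"
  \<comment> \<open>The second inclusion comes from the symmetry of equivalence. Equal sets of types
    then pair each world with one of the same type.\<close>
  then have "type_of (tests P n) M ` s = type_of (tests P n) M' ` s'"
    by (intro equalityI inqml_equiv_types_subset assms(1)) (rule inqml_equiv_sym)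
  then show "state_bisim P n M s M' s'"
    unfolding state_bisim_eq_set_match
    using assms(3,5)
    by (intro set_match_image_eq type_of_eq_world_bisim[OF assms(1,2,4)]) (blast+)
qed

end
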